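(* Let $k\ge0$ be an integer. The function $g_k$ has a holomorphic extension $G_k$ to $\mathbb C\setminus I_k$ satisfying $G_k(\overline z)=\overline{G_k(z)}$, where $I_k=[\Gamma(x_k),\Gamma(x_{k+1})]$ if $k$ is odd and $I_k=[-\Gamma(x_k),-\Gamma(x_{k+1})]$ if $k$ is even.
   Context: $\mathbb C_+$ is the open upper half plane, $\Gamma$ is Euler's gamma function and $\gamma$ Euler's constant. For $k\ge 1$, $x_k$ denotes the unique zero of $\Gamma'$ in $(-k,-k+1)$, and $x_0$ denotes the unique zero of $\Gamma'$ in $(0,\infty)$. One has $\Gamma(x_k)<0$ for $k$ odd and $\Gamma(x_k)>0$ for $k$ even. The function $\log\Gamma(z)=-\gamma z-\log z-\sum_{j=1}^\infty\left(\log(1+z/j)-z/j\right)$ (principal logarithms) is holomorphic in $\mathbb C\setminus(-\infty,0]$, and it maps $\mathbb C_+$ conformally (bijectively) onto the domain $\mathcal V=\mathbb C\setminus\bigcup_{k=0}^\infty\{x-ik\pi : x\ge\log|\Gamma(x_k)|\}$. $(\log\Gamma)^{-1}:\mathcal V\to\mathbb C_+$ denotes the inverse of this conformal map. For $k\in\mathbb Z$, $g_k(z)=(\log\Gamma)^{-1}(\log z-i(k+1)\pi)$ for $z\in\mathbb C_+$, with $\log$ the principal logarithm; $g_k$ is extended to the lower half plane by reflection, $g_k(z)=\overline{g_k(\overline z)}$. *)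

theory Defs
  imports "HOL-Complex_Analysis.Complex_Analysis"
begin

definition upper_half_plane :: "complex set" where
  "upper_half_plane = {z. Im z > 0}"

definition gamma_crit :: "nat \<Rightarrow> real" where
  "gamma_crit k =
     (if k = 0 then (THE x. 0 < x \<and> deriv (Gamma :: real \<Rightarrow> real) x = 0)
      else (THE x. - real k < x \<and> x < - real k + 1 \<and> deriv (Gamma :: real \<Rightarrow> real) x = 0))"

(* The summation index is shifted: j = Suc n with n = 0, 1, ...  The function coincides with
   ln_Gamma off the non-positive integers, see logGamma_eq_ln_Gamma below. *)
definition logGamma :: "complex \<Rightarrow> complex" where
  "logGamma z = - of_real euler_mascheroni * z - Ln z
     - (\<Sum>n. Ln (1 + z / of_nat (Suc n)) - z / of_nat (Suc n))"

lemma logGamma_eq_ln_Gamma: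
  assumes "z \<notin> \<int>\<^sub>\<le>\<^sub>0"
  shows "logGamma z = ln_Gamma z"
proof -
  have "(\<lambda>n. - (z / of_nat (Suc n) - Ln (1 + z / of_nat (Suc n)))) sums
          - (ln_Gamma z + euler_mascheroni * z + Ln z)"
    by (rule sums_minus [OF ln_Gamma_series'_aux [OF assms]])
  then have "(\<Sum>n. Ln (1 + z / of_nat (Suc n)) - z / of_nat (Suc n)) =
          - (ln_Gamma z + euler_mascheroni * z + Ln z)"
    by (simp add: sums_iff)
  then show ?thesis
    by (simp add: logGamma_def)
qed

(* The inverse of the conformal map logGamma from the upper half plane onto the slit plane
   V = C minus the rays {x - i k pi : x >= log |Gamma (gamma_crit k)|}, k = 0, 1, 2, ...
   Values outside the image V are irrelevant. *)
definition logGamma_inv :: "complex \<Rightarrow> complex" where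
  "logGamma_inv = inv_into upper_half_plane logGamma"

(* On the real axis g k is not defined by the construction. *)
definition g :: "int \<Rightarrow> complex \<Rightarrow> complex" where
  "g k z =
     (if Im z > 0 then logGamma_inv (Ln z - \<i> * of_int (k + 1) * of_real pi)
      else if Im z < 0 then cnj (logGamma_inv (Ln (cnj z) - \<i> * of_int (k + 1) * of_real pi))
      else undefined)"

definition I_slit :: "nat \<Rightarrow> complex set" where
  "I_slit k =
     (if odd k then complex_of_real ` {Gamma (gamma_crit k) .. Gamma (gamma_crit (k + 1))}
      else complex_of_real ` {- Gamma (gamma_crit k) .. - Gamma (gamma_crit (k + 1))})"

end

theory Submission
  imports Defs
begin

text \<open>
  On the upper half plane the derivative of \<open>logGamma\<close> is the digamma function, whose imaginary
  part is positive there, so \<open>logGamma\<close> is injective by the Noshiro--Warschawski criterion. Its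
  image contains every horizontal strip \<open>-(k+1)\<pi> < Im w < -k\<pi>\<close> with \<open>k \<ge> 0\<close>: the covered part
  of the strip is open and nonempty, and it is also closed. Indeed, let \<open>logGamma z\<^sub>n\<close> converge to a
  point of the strip. The imaginary part is positive for \<open>Re z \<ge> 2\<close> and tends to \<open>-\<infinity>\<close> to the left in
  bounded height, and where \<open>Im z\<close> is large a lower bound on \<open>Im (Digamma z)\<close> makes the image of a unit
  disc contain a disc of fixed radius; so either the limit is covered or \<open>z\<^sub>n\<close> is bounded. At real
  points the boundary value has imaginary part in \<open>\<pi>\<int>\<close>, or \<open>1/Gamma\<close> vanishes, so a subsequence
  converges inside the half plane.

  Between consecutive poles (and on the positive axis, \<open>m = 0\<close>) \<open>logGamma + i m \<pi>\<close> continues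
  holomorphically across the real axis, with the real values \<open>ln \<bar>Gamma x\<bar>\<close>. Away from the critical
  point this continuation is locally invertible, so the inverse has continuous real boundary values at
  the real points outside the slit, and the Schwarz reflection principle gives the extension.
\<close>

section \<open>Injectivity of log Gamma on the upper half plane\<close>

lemma not_nonpos_Int_if_Im: "Im z \<noteq> 0 \<Longrightarrow> z \<notin> \<int>\<^sub>\<le>\<^sub>0"
  by (auto elim!: nonpos_Ints_cases)

lemma not_nonpos_Real_if_Im: "Im z \<noteq> 0 \<Longrightarrow> z \<notin> \<real>\<^sub>\<le>\<^sub>0"
  by (auto elim!: nonpos_Reals_cases)

lemma logGamma_upper: "z \<in> upper_half_plane \<Longrightarrow> logGamma z = ln_Gamma z"
  by (intro logGamma_eq_ln_Gamma not_nonpos_Int_if_Im) (auto simp: upper_half_plane_def)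

lemma open_upper_half_plane: "open upper_half_plane"
  by (simp add: upper_half_plane_def open_halfspace_Im_gt)

lemma convex_upper_half_plane: "convex upper_half_plane"
  by (simp add: upper_half_plane_def convex_halfspace_Im_gt)

lemma has_field_derivative_logGamma:
  assumes "z \<in> upper_half_plane"
  shows "(logGamma has_field_derivative Digamma z) (at z)"
proof (rule has_field_derivative_transform_within_open)
  show "(ln_Gamma has_field_derivative Digamma z) (at z)"
    using assms by (intro has_field_derivative_ln_Gamma_complex not_nonpos_Real_if_Im)
      (auto simp: upper_half_plane_def)
qed (use assms open_upper_half_plane logGamma_upper in auto)

lemma holomorphic_on_logGamma: "logGamma holomorphic_on upper_half_plane"
  using has_field_derivative_logGamma open_upper_half_plane
  by (auto simp: holomorphic_on_open)

section \<open>Estimates for the digamma function\<close>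

lemma sums_Im_Digamma:
  assumes "z \<noteq> 0"
  shows "(\<lambda>n. Im z / ((Re z + n)\<^sup>2 + (Im z)\<^sup>2)) sums Im (Digamma z)"
proof -
  have "(\<lambda>n. inverse (of_nat (Suc n)) - inverse (z + of_nat n)) sums
          (Digamma z + of_real euler_mascheroni)"
    using summable_sums[OF summable_Digamma[OF assms]] by (simp add: Digamma_def)
  from sums_Im[OF this] show ?thesis
    by (simp add: power2_eq_square del: of_real_euler_mascheroni)
qed

lemma Im_Digamma_pos:
  assumes "Im z > 0"
  shows "Im (Digamma z) > 0"
proof -
  have z: "z \<noteq> 0" using assms by auto
  have "0 < (\<Sum>n. Im z / ((Re z + real n)\<^sup>2 + (Im z)\<^sup>2))"
    using assms by (intro suminf_pos sums_summable[OF sums_Im_Digamma[OF z]] divide_pos_pos add_nonneg_pos) auto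
  then show ?thesis
    using sums_Im_Digamma[OF z] by (simp add: sums_iff)
qed

text \<open>Since \<open>Re (1 / (z + n)) <= 1 / (Re z + n) <= 1 / (n + 2)\<close>, the series
  dominates the telescoping sum of \<open>1 / (n + 1) - 1 / (n + 2)\<close>, whose value 1 exceeds
  Euler's constant.\<close>

lemma Re_Digamma_pos:
  assumes "Re z \<ge> 2"
  shows "Re (Digamma z) > 0"
proof -
  have z: "z \<noteq> 0" using assms by auto
  have "(\<lambda>n. inverse (of_nat (Suc n)) - inverse (z + of_nat n)) sums
          (Digamma z + of_real euler_mascheroni)"
    using summable_sums[OF summable_Digamma[OF z]] by (simp add: Digamma_def)
  from sums_Re[OF this]
  have s: "(\<lambda>n. 1 / real (Suc n) - (Re z + real n) / ((Re z + real n)\<^sup>2 + (Im z)\<^sup>2)) sums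
          (Re (Digamma z) + euler_mascheroni)"
    by (simp add: power2_eq_square inverse_eq_divide Re_divide del: of_real_euler_mascheroni of_nat_Suc)
  have t: "(\<lambda>n. 1 / real (Suc n) - 1 / real (Suc (Suc n))) sums (1 - 0)"
    using telescope_sums'[OF LIMSEQ_inverse_real_of_nat] by (simp add: inverse_eq_divide)
  have "1 - 0 \<le> Re (Digamma z) + euler_mascheroni"
  proof (rule sums_le[OF _ t s])
    fix n
    have p: "Re z + real n > 0" using assms by linarith
    have "(Re z + real n) / ((Re z + real n)\<^sup>2 + (Im z)\<^sup>2) \<le> (Re z + real n) / ((Re z + real n)\<^sup>2)"
      using p by (intro divide_left_mono mult_pos_pos) (auto intro: add_pos_nonneg)
    also have "\<dots> = 1 / (Re z + real n)"
      using p by (simp add: power2_eq_square)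
    also have "\<dots> \<le> 1 / real (Suc (Suc n))"
      using assms by (intro divide_left_mono) auto
    finally show "1 / real (Suc n) - 1 / real (Suc (Suc n)) \<le>
        1 / real (Suc n) - (Re z + real n) / ((Re z + real n)\<^sup>2 + (Im z)\<^sup>2)"
      by linarith
  qed
  then show ?thesis
    using euler_mascheroni_less_13_over_22 by simp
qed

text \<open>About \<open>Im z\<close> consecutive terms of the series are at least
  \<open>1 / (17 * Im z)\<close> each: they start where \<open>Re z + n\<close> lies between 0 and
  3, and along them it stays at most \<open>4 * Im z\<close>, which bounds the denominator by
  \<open>(16 + 1) * (Im z)^2\<close>.\<close>

lemma Im_Digamma_ge:
  assumes "Re z \<le> 3" "Im z \<ge> 1"
  shows "Im (Digamma z) \<ge> 1 / 17"
proof -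
  define N where "N = nat \<lceil>- Re z\<rceil>"
  define M where "M = nat \<lceil>Im z\<rceil>"
  have N: "0 \<le> Re z + N" "Re z + N \<le> 3"
    using assms unfolding N_def by linarith+
  have M: "Im z \<le> M" "real M < Im z + 1"
    using assms unfolding M_def by linarith+
  have z: "z \<noteq> 0" using assms by auto
  have pos: "0 \<le> Im z / ((Re z + real n)\<^sup>2 + (Im z)\<^sup>2)" for n
    using assms by auto
  have "1 / 17 \<le> real M * (1 / (17 * Im z))"
    using M assms by (simp add: field_simps)
  also have "\<dots> \<le> (\<Sum>n=N..<N+M. Im z / ((Re z + real n)\<^sup>2 + (Im z)\<^sup>2))"
  proof -
    have "1 / (17 * Im z) \<le> Im z / ((Re z + real n)\<^sup>2 + (Im z)\<^sup>2)" if "n \<in> {N..<N+M}" for n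
    proof -
      have "real n \<le> real N + real M - 1" "real n \<ge> real N" using that by auto
      then have "0 \<le> Re z + real n" "Re z + real n \<le> 4 * Im z"
        using N M assms by linarith+
      then have "(Re z + real n)\<^sup>2 \<le> (4 * Im z)\<^sup>2"
        by (intro power_mono)
      then have "(Re z + real n)\<^sup>2 + (Im z)\<^sup>2 \<le> 17 * (Im z)\<^sup>2"
        by (simp add: power_mult_distrib)
      then have "Im z / (17 * (Im z)\<^sup>2) \<le> Im z / ((Re z + real n)\<^sup>2 + (Im z)\<^sup>2)"
        using assms by (intro divide_left_mono mult_pos_pos add_nonneg_pos) auto
      then show ?thesis using assms by (simp add: power2_eq_square)
    qed
    then show ?thesis
      using sum_bounded_below[of "{N..<N+M}" "1 / (17 * Im z)"] by simp
  qed
  also have "\<dots> \<le> (\<Sum>n. Im z / ((Re z + real n)\<^sup>2 + (Im z)\<^sup>2))"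
    using pos by (intro sum_le_suminf sums_summable[OF sums_Im_Digamma[OF z]]) auto
  finally show ?thesis
    using sums_Im_Digamma[OF z] by (simp add: sums_iff)
qed

text \<open>The mean value theorem on a segment, applied to \<open>c / (b - a) * f\<close>. The
  factor \<open>c\<close> selects the direction onto which the difference quotient is projected;
  \<open>c = -i\<close> extracts the imaginary part.\<close>

lemma complex_mvt_quotient:
  assumes "a \<noteq> b"
    and "\<And>u. u \<in> closed_segment a b \<Longrightarrow> (f has_field_derivative f' u) (at u)"
  obtains u where "u \<in> closed_segment a b" "Re (c * ((f b - f a) / (b - a))) = Re (c * f' u)"
proof -
  have "\<exists>u. u \<in> closed_segment a b \<and>
      Re (c / (b - a) * f b) - Re (c / (b - a) * f a) = Re (c / (b - a) * f' u * (b - a))"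
    using assms by (intro complex_mvt_line DERIV_cmult) auto
  then obtain u where u: "u \<in> closed_segment a b"
      "Re (c / (b - a) * f b) - Re (c / (b - a) * f a) = Re (c / (b - a) * f' u * (b - a))" by blast
  moreover have "c / (b - a) * f b - c / (b - a) * f a = c * ((f b - f a) / (b - a))"
    by (simp add: right_diff_distrib diff_divide_distrib)
  moreover have "c / (b - a) * f' u * (b - a) = c * f' u"
    using assms(1) by simp
  ultimately show thesis
    using that by (metis minus_complex.sel(1))
qed

text \<open>If \<open>f a = f b\<close> with distinct \<open>a\<close> and \<open>b\<close>, the
  difference quotient vanishes, although its projection equals a positive
  \<open>Re (c * f' u)\<close>.\<close>

lemma inj_on_if_Re_deriv_pos:
  assumes "convex S" "\<And>z. z \<in> S \<Longrightarrow> (f has_field_derivative f' z) (at z)"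
    and "\<And>z. z \<in> S \<Longrightarrow> Re (c * f' z) > 0"
  shows "inj_on f S"
proof (rule inj_onI, rule ccontr)
  fix a b assume ab: "a \<in> S" "b \<in> S" "f a = f b" "a \<noteq> b"
  have seg: "closed_segment a b \<subseteq> S"
    using ab assms(1) by (simp add: closed_segment_subset)
  obtain u where "u \<in> closed_segment a b" "Re (c * ((f b - f a) / (b - a))) = Re (c * f' u)"
    using complex_mvt_quotient[of a b f f' c] ab seg assms(2) by blast
  with assms(3)[of u] seg ab show False by auto
qed

lemma inj_on_logGamma: "inj_on logGamma upper_half_plane"
  using convex_upper_half_plane has_field_derivative_logGamma
  by (rule inj_on_if_Re_deriv_pos[where c = "- \<i>"])
     (auto simp: upper_half_plane_def intro!: Im_Digamma_pos)

section \<open>The inverse map and the images of open sets\<close>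

lemma logGamma_inv_logGamma: "z \<in> upper_half_plane \<Longrightarrow> logGamma_inv (logGamma z) = z"
  unfolding logGamma_inv_def by (rule inv_into_f_f[OF inj_on_logGamma])

lemma open_logGamma_image: "open S \<Longrightarrow> S \<subseteq> upper_half_plane \<Longrightarrow> open (logGamma ` S)"
  by (meson holomorphic_on_logGamma holomorphic_on_subset inj_on_logGamma inj_on_subset open_mapping_thm3)

lemma logGamma_inv_holomorphic: "logGamma_inv holomorphic_on (logGamma ` upper_half_plane)"
proof -
  obtain h where "h holomorphic_on (logGamma ` upper_half_plane)"
    "\<And>z. z \<in> upper_half_plane \<Longrightarrow> h (logGamma z) = z"
    using holomorphic_has_inverse[OF holomorphic_on_logGamma open_upper_half_plane inj_on_logGamma] by metis
  then show ?thesis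
    by (auto simp: logGamma_inv_logGamma intro: holomorphic_transform)
qed

text \<open>The unit circle around \<open>z\<close> is mapped to points at distance at least 1/17
  from \<open>logGamma z\<close>, and the image of the disc is open. The radius is independent of
  \<open>z\<close>, so limits along sequences of large height are covered.\<close>

lemma ball_subset_logGamma_image:
  assumes "Re z \<le> 2" "Im z \<ge> 2"
  shows "ball (logGamma z) (1 / 17) \<subseteq> logGamma ` upper_half_plane"
proof -
  \<comment> \<open>The unit disc around \<open>z\<close> stays in the region where
    \<open>Im_Digamma_ge\<close> applies.\<close>
  have cb: "Re u \<le> 3 \<and> Im u \<ge> 1" if "u \<in> cball z 1" for u
    using that assms abs_Re_le_cmod[of "z - u"] abs_Im_le_cmod[of "z - u"]
    by (auto simp: dist_norm)
  then have sub: "cball z 1 \<subseteq> upper_half_plane"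
    by (force simp: upper_half_plane_def)
  have "ball (logGamma z) (1 / 17) \<subseteq> logGamma ` ball z 1"
  proof (rule ball_subset_open_map_image)
    show "continuous_on (closure (ball z 1)) logGamma"
      using sub holomorphic_on_imp_continuous_on[OF holomorphic_on_logGamma] continuous_on_subset by auto
    show "open (logGamma ` interior (ball z 1))"
      using sub by (intro open_logGamma_image) auto
    fix w assume "w \<in> frontier (ball z 1)"
    then have w: "dist z w = 1" by (simp add: frontier_ball)
    then have zw: "z \<noteq> w" by auto
    have seg: "closed_segment z w \<subseteq> cball z 1"
      using w by (intro closed_segment_subset) auto
    obtain u where u: "u \<in> closed_segment z w"
      "Re (- \<i> * ((logGamma w - logGamma z) / (w - z))) = Re (- \<i> * Digamma u)"
      using complex_mvt_quotient[OF zw, of logGamma Digamma "- \<i>"] seg sub has_field_derivative_logGamma by blast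
    have "1 / 17 \<le> Im (Digamma u)"
      using u(1) seg cb by (intro Im_Digamma_ge) auto
    also have "\<dots> \<le> norm (- \<i> * ((logGamma w - logGamma z) / (w - z)))"
      using u(2) complex_Re_le_cmod[of "- \<i> * ((logGamma w - logGamma z) / (w - z))"] by simp
    also have "\<dots> = norm (logGamma w - logGamma z)"
      using w by (simp add: norm_mult norm_divide dist_norm norm_minus_commute)
    finally show "1 / 17 \<le> norm (logGamma w - logGamma z)" .
  qed auto
  also have "\<dots> \<subseteq> logGamma ` upper_half_plane"
    using sub by force
  finally show ?thesis .
qed

text \<open>On the vertical segment from \<open>Re z\<close>, where \<open>ln_Gamma\<close> is real,
  up to \<open>z\<close>, the imaginary part grows at the rate
  \<open>Re (Digamma u) > 0\<close>.\<close>

lemma Im_logGamma_pos: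
  assumes "Re z \<ge> 2" "Im z > 0"
  shows "Im (logGamma z) > 0"
proof -
  define x where "x = complex_of_real (Re z)"
  have xz: "x \<noteq> z" using assms by (auto simp: x_def complex_eq_iff)
  have seg: "Re u = Re z" if "u \<in> closed_segment x z" for u
    using that by (auto simp: closed_segment_def x_def left_diff_distrib)
  obtain u where u: "u \<in> closed_segment x z"
     "Re (1 * ((ln_Gamma z - ln_Gamma x) / (z - x))) = Re (1 * Digamma u)"
  proof (rule complex_mvt_quotient[OF xz])
    fix u assume "u \<in> closed_segment x z"
    then show "(ln_Gamma has_field_derivative Digamma u) (at u)"
      using seg[of u] assms by (intro has_field_derivative_ln_Gamma_complex) (auto simp: complex_nonpos_Reals_iff)
  qed
  have "z - x = \<i> * of_real (Im z)"
    by (simp add: x_def complex_eq_iff)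
  moreover have "Im (ln_Gamma x) = 0"
    using assms by (simp add: x_def ln_Gamma_complex_of_real)
  ultimately have "Im (ln_Gamma z) / Im z = Re (Digamma u)"
    using u(2) assms by (simp add: Re_divide power2_eq_square)
  moreover have "Re (Digamma u) > 0"
    using seg[OF u(1)] assms by (intro Re_Digamma_pos) simp
  ultimately show ?thesis
    using assms by (metis logGamma_upper mem_Collect_eq upper_half_plane_def zero_less_divide_iff
        order_less_asym)
qed

text \<open>The defect \<open>d\<close> has derivative zero on the connected slit plane, which,
  unlike the open half plane, contains the point 1, where \<open>d\<close> can be evaluated.\<close>

lemma logGamma_plus1:
  assumes "z \<in> upper_half_plane"
  shows "logGamma (z + 1) = logGamma z + Ln z"
proof -
  define d where "d u = ln_Gamma (u + 1) - ln_Gamma u - Ln u" for u :: complex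
  define S :: "complex set" where "S = - \<real>\<^sub>\<le>\<^sub>0"
  have "(d has_field_derivative 0) (at u)" if "u \<in> S" for u
  proof -
    have u: "u \<notin> \<real>\<^sub>\<le>\<^sub>0" "u + 1 \<notin> \<real>\<^sub>\<le>\<^sub>0"
      using that by (auto simp: S_def complex_nonpos_Reals_iff)
    then have "u \<noteq> 0" by auto
    then show ?thesis
      unfolding d_def using u
      by (auto intro!: derivative_eq_intros simp: Digamma_plus1 divide_inverse)
  qed
  moreover have "\<real>\<^sub>\<le>\<^sub>0 = complex_of_real ` {..0}"
    by (auto simp: nonpos_Reals_def)
  then have "connected S"
    using starlike_imp_connected[OF starlike_slotted_complex_plane_left[of 0]]
    by (simp add: S_def)
  moreover have "open S"
    by (simp add: S_def open_Compl)
  ultimately have "d constant_on S"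
    by (intro has_field_derivative_0_imp_constant_on)
  moreover have "1 \<in> S" "z \<in> S"
    using assms by (auto simp: S_def upper_half_plane_def complex_nonpos_Reals_iff)
  ultimately have "d z = d 1"
    by (metis constant_on_def)
  moreover have "d 1 = 0"
    using ln_Gamma_complex_conv_fact[of 1] ln_Gamma_complex_conv_fact[of 2]
    by (simp add: d_def)
  moreover have "z + 1 \<in> upper_half_plane"
    using assms by (simp add: upper_half_plane_def)
  ultimately show ?thesis
    using assms by (simp add: d_def logGamma_upper algebra_simps)
qed

section \<open>Continuation across the intervals between poles\<close>

lemma logGamma_plus_of_nat:
  assumes "z \<in> upper_half_plane"
  shows "logGamma (z + of_nat n) = logGamma z + (\<Sum>j<n. Ln (z + of_nat j))"
proof (induction n)
  case (Suc n)
  have "z + of_nat n \<in> upper_half_plane"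
    using assms by (simp add: upper_half_plane_def)
  from logGamma_plus1[OF this] show ?case
    using Suc by (simp add: add_ac)
qed simp

text \<open>The components of the real line minus the poles of Gamma, numbered so that the
  \<open>m\<close>-th one contains the critical point \<open>gamma_crit m\<close>.\<close>

definition pole_gap :: "nat \<Rightarrow> real set" where
  "pole_gap m = {x. - real m < x \<and> (m = 0 \<or> x < 1 - real m)}"

text \<open>The recurrence for \<open>logGamma (z + m)\<close> with each \<open>Ln (z + j)\<close>
  replaced by \<open>Ln (- (z + j))\<close>. Over the gap \<open>Re (z + j) < 0\<close>, so the
  latter is off its cut; on the upper half plane every replacement subtracts \<open>i * pi\<close>
  from the logarithm.\<close>

definition logGamma_branch :: "nat \<Rightarrow> complex \<Rightarrow> complex" where
  "logGamma_branch m z = ln_Gamma (z + of_nat m) - (\<Sum>j<m. Ln (- (z + of_nat j)))"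

lemma pole_gap_iff: "x \<in> pole_gap m \<longleftrightarrow> 0 < x + m \<and> (\<forall>j<m. x + j < 0)"
proof
  assume x: "x \<in> pole_gap m"
  show "0 < x + m \<and> (\<forall>j<m. x + j < 0)"
  proof (intro conjI allI impI)
    fix j assume "j < m"
    then have "real j \<le> real m - 1" by linarith
    then show "x + real j < 0" using x \<open>j < m\<close> by (auto simp: pole_gap_def)
  qed (use x in \<open>auto simp: pole_gap_def\<close>)
next
  assume x: "0 < x + m \<and> (\<forall>j<m. x + j < 0)"
  then have "m = 0 \<or> x + real (m - 1) < 0" by (metis diff_less gr0I zero_less_one)
  with x show "x \<in> pole_gap m" by (cases m) (auto simp: pole_gap_def)
qed

lemma Re_in_pole_gap_not_nonpos_Int: "Re z \<in> pole_gap m \<Longrightarrow> z \<notin> \<int>\<^sub>\<le>\<^sub>0"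
proof
  assume z: "Re z \<in> pole_gap m" "z \<in> \<int>\<^sub>\<le>\<^sub>0"
  then obtain n where n: "z = - of_nat n" by (auto elim!: nonpos_Ints_cases')
  then show False using z(1) by (cases "n < m") (auto simp: pole_gap_iff)
qed

lemma pole_gap_not_nonpos_Int: "x \<in> pole_gap m \<Longrightarrow> x \<notin> \<int>\<^sub>\<le>\<^sub>0"
  using Re_in_pole_gap_not_nonpos_Int[of "of_real x" m] by (simp add: of_real_in_nonpos_Ints_iff)

lemma open_pole_gap: "open (pole_gap m)"
proof -
  have "pole_gap m = (if m = 0 then {0<..} else {- real m<..<1 - real m})"
    by (auto simp: pole_gap_def)
  then show ?thesis by simp
qed

lemma open_pole_gap_strip: "open {z. Re z \<in> pole_gap m}"
  using open_vimage[OF open_pole_gap continuous_on_Re[OF continuous_on_id]] by (simp add: vimage_def)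

lemma in_pole_gap_if_not_nonpos_Int:
  assumes "x \<notin> \<int>\<^sub>\<le>\<^sub>0"
  obtains m where "x \<in> pole_gap m"
proof
  \<comment> \<open>For \<open>x > 0\<close> the truncation in \<open>nat\<close> yields the gap
    with index 0; otherwise \<open>x\<close> is not an integer and the ceiling gives strict
    bounds.\<close>
  show "x \<in> pole_gap (nat \<lceil>- x\<rceil>)"
  proof (cases "x > 0")
    case False
    have "x \<noteq> of_int (- \<lceil>- x\<rceil>)"
    proof
      assume "x = of_int (- \<lceil>- x\<rceil>)"
      moreover have "- \<lceil>- x\<rceil> \<le> 0" using False by simp
      ultimately show False using assms nonpos_Ints_of_int by metis
    qed
    moreover have "of_int \<lceil>- x\<rceil> \<ge> - x" "of_int \<lceil>- x\<rceil> < - x + 1" by linarith+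
    ultimately have "- of_int \<lceil>- x\<rceil> < x" "x < 1 - of_int \<lceil>- x\<rceil>"
      by (metis minus_le_iff of_int_minus order_le_imp_less_or_eq, linarith)
    then show ?thesis using False
      by (auto simp: pole_gap_def)
  qed (simp add: pole_gap_def)
qed

lemma Digamma_plus_of_nat:
  fixes z :: complex
  assumes "z \<notin> \<int>\<^sub>\<le>\<^sub>0"
  shows "Digamma (z + of_nat m) = Digamma z + (\<Sum>j<m. 1 / (z + of_nat j))"
proof (induction m)
  case (Suc m)
  have "z + of_nat m \<noteq> 0"
    using assms by (metis add_eq_0_iff2 minus_of_nat_in_nonpos_Ints)
  from Digamma_plus1[OF this] show ?case using Suc by (simp add: add_ac)
qed simp

lemma has_field_derivative_logGamma_branch:
  assumes "Re z \<in> pole_gap m"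
  shows "(logGamma_branch m has_field_derivative Digamma z) (at z)"
proof -
  have 1: "z + of_nat m \<notin> \<real>\<^sub>\<le>\<^sub>0" "\<And>j. j < m \<Longrightarrow> - (z + of_nat j) \<notin> \<real>\<^sub>\<le>\<^sub>0"
    using assms by (auto simp: pole_gap_iff complex_nonpos_Reals_iff)
  have "((\<lambda>z. ln_Gamma (z + of_nat m) - (\<Sum>j<m. Ln (- (z + of_nat j)))) has_field_derivative
     Digamma (z + of_nat m) - (\<Sum>j<m. 1 / (z + of_nat j))) (at z)"
  proof (intro DERIV_diff DERIV_sum)
    show "((\<lambda>z. ln_Gamma (z + of_nat m)) has_field_derivative Digamma (z + of_nat m)) (at z)"
      using 1(1) by (auto intro!: derivative_eq_intros)
  next
    fix j assume j: "j \<in> {..<m}"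
    show "((\<lambda>z. Ln (- (z + of_nat j))) has_field_derivative 1 / (z + of_nat j)) (at z)"
    proof -
      have "- (z + of_nat j) \<notin> \<real>\<^sub>\<le>\<^sub>0" using 1(2) j by blast
      moreover from this have "z + of_nat j \<noteq> 0" by (auto simp del: minus_add_distrib)
      ultimately show ?thesis
        by (auto intro!: derivative_eq_intros simp: divide_simps)
    qed
  qed
  then show ?thesis
    unfolding logGamma_branch_def Digamma_plus_of_nat[OF Re_in_pole_gap_not_nonpos_Int[OF assms]]
    by simp
qed

lemma logGamma_eq_branch:
  assumes "z \<in> upper_half_plane" "Re z \<in> pole_gap m"
  shows "logGamma z = logGamma_branch m z - \<i> * of_nat m * pi"
proof -
  have "Ln (- (z + of_nat j)) = Ln (z + of_nat j) - \<i> * pi" for j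
  proof -
    have "Im (z + of_nat j) > 0" using assms by (simp add: upper_half_plane_def)
    then have "z + of_nat j \<noteq> 0" "\<not> Im (z + of_nat j) \<le> 0"
      by (metis order_less_irrefl zero_complex.simps(2), simp)
    then show ?thesis by (metis Ln_minus)
  qed
  moreover have "z + of_nat m \<in> upper_half_plane"
    using assms by (simp add: upper_half_plane_def)
  ultimately show ?thesis
    using logGamma_plus_of_nat[OF assms(1), of m] logGamma_upper[of "z + of_nat m"]
    by (simp add: logGamma_branch_def sum_subtractf mult_ac)
qed

text \<open>The logarithms exponentiate to \<open>(-1) ^ m\<close> times the Pochhammer symbol,
  which is the quotient of \<open>Gamma (z + m)\<close> by \<open>Gamma z\<close>.\<close>

lemma exp_logGamma_branch:
  assumes "Re z \<in> pole_gap m"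
  shows "exp (logGamma_branch m z) = (-1) ^ m * Gamma z"
proof -
  have z: "z \<notin> \<int>\<^sub>\<le>\<^sub>0" by (rule Re_in_pole_gap_not_nonpos_Int[OF assms])
  have zm: "z + of_nat m \<notin> \<int>\<^sub>\<le>\<^sub>0"
  proof
    assume "z + of_nat m \<in> \<int>\<^sub>\<le>\<^sub>0"
    then obtain n where "z + of_nat m = of_int n" "n \<le> 0" by (elim nonpos_Ints_cases)
    then have "Re (z + of_nat m) = of_int n" "n \<le> 0" by auto
    with assms show False by (simp add: pole_gap_iff)
  qed
  have ne: "z + of_nat j \<noteq> 0" for j
    using z by (metis add_eq_0_iff2 minus_of_nat_in_nonpos_Ints)
  have "exp (\<Sum>j<m. Ln (- (z + of_nat j))) = (\<Prod>j<m. - (z + of_nat j))"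
    unfolding exp_sum[OF finite_lessThan]
  proof (rule prod.cong)
    fix j show "exp (Ln (- (z + of_nat j))) = - (z + of_nat j)"
      using ne[of j] by (intro exp_Ln) (metis neg_0_equal_iff_equal minus_minus)
  qed simp
  also have "\<dots> = (-1) ^ m * pochhammer z m"
    by (simp only: prod_uminus pochhammer_prod atLeast0LessThan card_lessThan)
  finally have "exp (logGamma_branch m z) = Gamma (z + of_nat m) / ((-1) ^ m * pochhammer z m)"
    using zm by (simp add: logGamma_branch_def exp_diff Gamma_complex_altdef)
  also have "\<dots> = (-1) ^ m * Gamma z"
    using z zm by (simp add: pochhammer_Gamma Gamma_eq_zero_iff divide_simps)
  finally show ?thesis .
qed

lemma logGamma_branch_of_real:
  assumes "x \<in> pole_gap m"
  shows "logGamma_branch m (of_real x) = of_real (ln \<bar>Gamma x\<bar>)"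
proof -
  have "logGamma_branch m (of_real x) = of_real (ln_Gamma (x + m) - (\<Sum>j<m. ln (- (x + j))))"
  proof -
    have "Ln (- (of_real x + of_nat j)) = of_real (ln (- (x + j)))" if "j < m" for j
    proof -
      have "- (x + real j) > 0" using assms that unfolding pole_gap_iff by fastforce
      from Ln_of_real[OF this] show ?thesis by simp
    qed
    moreover have "ln_Gamma (of_real x + of_nat m) = complex_of_real (ln_Gamma (x + m))"
      using ln_Gamma_complex_of_real[of "x + m"] assms by (simp add: pole_gap_iff)
    ultimately show ?thesis
      by (simp add: logGamma_branch_def)
  qed
  \<comment> \<open>Once the value is known to be real, the modulus of its exponential determines
    it, without evaluating the sum.\<close>
  then obtain y where y: "logGamma_branch m (of_real x) = of_real y" by blast
  have "exp (of_real y) = (-1) ^ m * complex_of_real (Gamma x)"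
    using exp_logGamma_branch[of "of_real x" m] assms by (simp add: y Gamma_complex_of_real)
  then have "norm (exp (complex_of_real y)) = \<bar>Gamma x\<bar>"
    by (simp add: norm_mult norm_power)
  then have "y = ln \<bar>Gamma x\<bar>"
    by (metis Re_complex_of_real ln_exp norm_exp_eq_Re)
  with y show ?thesis by simp
qed

text \<open>The continuation is continuous at \<open>x\<close>. The boundary values thus lie on the
  lines \<open>Im w = - m * pi\<close>, outside all the open strips between them.\<close>

lemma logGamma_tendsto_boundary:
  assumes "x \<in> pole_gap m"
  shows "(logGamma \<longlongrightarrow> of_real (ln \<bar>Gamma x\<bar>) - \<i> * of_nat m * pi)
           (at (of_real x) within upper_half_plane)"
proof -
  have "((\<lambda>z. logGamma_branch m z - \<i> * of_nat m * pi) \<longlongrightarrow> logGamma_branch m (of_real x) - \<i> * of_nat m * pi)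
           (at (of_real x) within upper_half_plane)"
  proof (intro tendsto_intros)
    have "isCont (logGamma_branch m) (of_real x)"
      using assms by (intro DERIV_isCont[OF has_field_derivative_logGamma_branch]) simp
    then show "(logGamma_branch m \<longlongrightarrow> logGamma_branch m (of_real x)) (at (of_real x) within upper_half_plane)"
      using continuous_at_imp_continuous_at_within continuous_within by blast
  qed
  moreover have "\<forall>\<^sub>F z in at (complex_of_real x) within upper_half_plane.
      logGamma z = logGamma_branch m z - \<i> * of_nat m * pi"
    unfolding eventually_at_topological
    using open_pole_gap_strip[of m] assms logGamma_eq_branch[of _ m]
    by (intro exI[of _ "{z. Re z \<in> pole_gap m}"]) auto
  ultimately show ?thesis
    by (simp add: tendsto_cong logGamma_branch_of_real[OF assms])
qed

lemma exp_logGamma: "z \<in> upper_half_plane \<Longrightarrow> exp (logGamma z) = Gamma z"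
  by (simp add: logGamma_upper Gamma_complex_altdef upper_half_plane_def not_nonpos_Int_if_Im)

section \<open>Horizontal strips in the image of log Gamma\<close>

text \<open>The first \<open>n\<close> shifted points have nonpositive real part, so their
  logarithms contribute at least \<open>pi / 2\<close> each; the other shifts contribute positive
  amounts.\<close>

lemma Im_logGamma_le_shift:
  assumes z: "z \<in> upper_half_plane" and "Re z + real n \<le> 1" "n \<le> N"
  shows "Im (logGamma z) \<le> Im (logGamma (z + of_nat N)) - real n * (pi / 2)"
proof -
  have pos: "0 < Im (Ln (z + of_nat j)) \<and> Im (Ln (z + of_nat j)) < pi" for j
    using z by (intro Im_Ln_pos_lt_imp) (simp add: upper_half_plane_def)
  have "pi / 2 \<le> Im (Ln (z + of_nat j))" if "j < n" for j
  proof -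
    have "real j \<le> real n - 1" using that by simp
    then have re: "Re (z + of_nat j) \<le> 0" using assms by simp
    have "Im (z + of_nat j) > 0" using z by (simp add: upper_half_plane_def)
    then have nz: "z + of_nat j \<noteq> 0" by (metis order_less_irrefl zero_complex.simps(2))
    have "\<not> \<bar>Im (Ln (z + of_nat j))\<bar> < pi / 2"
      using Re_Ln_pos_lt[OF nz] re by linarith
    then show ?thesis using pos[of j] by linarith
  qed
  then have "real n * (pi / 2) \<le> (\<Sum>j<n. Im (Ln (z + of_nat j)))"
    using sum_bounded_below[of "{..<n}" "pi / 2"] by simp
  also have "\<dots> \<le> (\<Sum>j<N. Im (Ln (z + of_nat j)))"
    using pos \<open>n \<le> N\<close> by (intro sum_mono2) (auto intro: less_imp_le)
  also have "\<dots> = Im (logGamma (z + of_nat N)) - Im (logGamma z)"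
    using logGamma_plus_of_nat[OF z, of N] by simp
  finally show ?thesis by linarith
qed

text \<open>Shifting to the right moves \<open>z\<close> into a fixed compact box where
  \<open>ln_Gamma\<close> is bounded, and the number of shifts grows with
  \<open>- Re z\<close>.\<close>

lemma Im_logGamma_uniformly_at_bot:
  "\<exists>M. \<forall>z \<in> upper_half_plane. Im z \<le> 2 \<longrightarrow> Re z \<le> M \<longrightarrow> Im (logGamma z) < c"
proof -
  define K where "K = cbox 1 (Complex 2 2)"
  have "continuous_on K ln_Gamma"
    by (intro continuous_on_ln_Gamma_complex) (auto simp: K_def in_cbox_complex_iff complex_nonpos_Reals_iff)
  then have "bounded (ln_Gamma ` K)"
    by (intro compact_imp_bounded compact_continuous_image) (simp_all add: K_def)
  then obtain B where B: "\<And>z. z \<in> K \<Longrightarrow> norm (ln_Gamma z) \<le> B"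
    by (auto simp: bounded_iff)
  obtain m :: nat where m: "B - c < real m" using reals_Archimedean2 by blast
  show ?thesis
  proof (intro exI ballI impI)
    fix z assume z: "z \<in> upper_half_plane" "Im z \<le> 2" "Re z \<le> - real m - 1"
    \<comment> \<open>Then \<open>Re z + n\<close> is in (-1, 0], so that \<open>n + 2\<close>
      shifts end in (1, 2], within \<open>K\<close>.\<close>
    define n where "n = nat \<lfloor>- Re z\<rfloor>"
    have n: "real n \<le> - Re z" "- Re z < real n + 1" "real m \<le> n"
      using z unfolding n_def by linarith+
    have u: "z + of_nat (n + 2) \<in> upper_half_plane"
      using z by (simp add: upper_half_plane_def)
    have "z + of_nat (n + 2) \<in> K"
      using n z by (auto simp: K_def in_cbox_complex_iff upper_half_plane_def)
    then have "Im (logGamma (z + of_nat (n + 2))) \<le> B"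
      using B[of "z + of_nat (n + 2)"] abs_Im_le_cmod[of "ln_Gamma (z + of_nat (n + 2))"]
      unfolding logGamma_upper[OF u] by linarith
    moreover have "Im (logGamma z) \<le> Im (logGamma (z + of_nat (n + 2))) - real n * (pi / 2)"
      using z n by (intro Im_logGamma_le_shift) auto
    moreover have "real n * 1 \<le> real n * (pi / 2)"
      using pi_ge_two by (intro mult_left_mono) auto
    ultimately show "Im (logGamma z) < c" using m n by linarith
  qed
qed

text \<open>This is the closedness of the covered part of a strip.\<close>

lemma in_logGamma_image_if_tendsto:
  assumes z: "\<And>n. z n \<in> upper_half_plane" and lim: "(\<lambda>n. logGamma (z n)) \<longlonglongrightarrow> w"
    and w: "- real (k + 1) * pi < Im w" "Im w < - real k * pi"
  shows "w \<in> logGamma ` upper_half_plane"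
proof -
  obtain M where M: "\<forall>z \<in> upper_half_plane. Im z \<le> 2 \<longrightarrow> Re z \<le> M \<longrightarrow>
      Im (logGamma z) < - real (k + 1) * pi"
    using Im_logGamma_uniformly_at_bot[of "- real (k + 1) * pi"] by (elim exE)
  have limIm: "(\<lambda>n. Im (logGamma (z n))) \<longlonglongrightarrow> Im w"
    by (intro tendsto_intros lim)
  have "Im w < 0" using w(2) by (rule less_le_trans) simp
  then have "\<forall>\<^sub>F n in sequentially. Im (logGamma (z n)) < 0 \<and> - real (k + 1) * pi < Im (logGamma (z n)) \<and>
      dist (logGamma (z n)) w < 1 / 17"
    using order_tendstoD[OF limIm] w(1) tendstoD[OF lim, of "1 / 17"] by (auto simp: eventually_conj_iff)
  then obtain n0 where n0: "\<And>n. n \<ge> n0 \<Longrightarrow> Im (logGamma (z n)) < 0"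
     "\<And>n. n \<ge> n0 \<Longrightarrow> - real (k + 1) * pi < Im (logGamma (z n))"
     "\<And>n. n \<ge> n0 \<Longrightarrow> dist (logGamma (z n)) w < 1 / 17"
    by (auto simp: eventually_sequentially)
  have Im_pos: "Im (z n) > 0" for n using z by (simp add: upper_half_plane_def)
  have re: "Re (z n) < 2" if "n \<ge> n0" for n
    using Im_logGamma_pos[of "z n"] n0(1)[OF that] Im_pos[of n] by linarith
  show ?thesis
  proof (cases "\<exists>n\<ge>n0. Im (z n) \<ge> 2")
    \<comment> \<open>A single late point of height at least 2 suffices: the limit is in the disc of
      radius 1/17 around its image.\<close>
    case True
    then obtain n where n: "n \<ge> n0" "Im (z n) \<ge> 2" by blast
    then have "w \<in> ball (logGamma (z n)) (1 / 17)" using n0(3) by simp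
    then show ?thesis
      using ball_subset_logGamma_image[of "z n"] n re[of n] by fastforce
  next
    case False
    define y where "y n = z (n + n0)" for n
    \<comment> \<open>The right edge comes from \<open>Im_logGamma_pos\<close>, as the images have
      negative imaginary part; the left edge \<open>M\<close> comes from their lower bound
      \<open>- (k + 1) * pi\<close>.\<close>
    have "y n \<in> cbox (Complex M 0) (Complex 2 2)" for n
    proof -
      have "Im (y n) < 2" using False by (auto simp: y_def not_le)
      moreover have "M < Re (y n)"
        using bspec[OF M z[of "n + n0"]] n0(2)[of "n + n0"] \<open>Im (y n) < 2\<close> by (simp add: y_def)
      ultimately show ?thesis
        using re[of "n + n0"] Im_pos[of "n + n0"] by (simp add: y_def in_cbox_complex_iff)
    qed
    then obtain l r where l: "l \<in> cbox (Complex M 0) (Complex 2 2)" "strict_mono r" "(y \<circ> r) \<longlonglongrightarrow> l"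
      using compact_cbox compact_imp_seq_compact seq_compactE by metis
    have limy: "(\<lambda>n. logGamma ((y \<circ> r) n)) \<longlonglongrightarrow> w"
      using LIMSEQ_subseq_LIMSEQ[OF LIMSEQ_ignore_initial_segment[OF lim, of n0] l(2)]
      by (simp add: y_def o_def)
    have yup: "(y \<circ> r) n \<in> upper_half_plane" for n using z by (simp add: y_def)
    have l0: "Im l \<ge> 0" using l(1) by (simp add: in_cbox_complex_iff)
    show ?thesis
    proof (cases "Im l = 0")
      case False
      then have lu: "l \<in> upper_half_plane" using l0 by (simp add: upper_half_plane_def)
      then have "isCont logGamma l"
        by (intro DERIV_isCont[OF has_field_derivative_logGamma])
      from isCont_tendsto_compose[OF this l(3)] have "w = logGamma l"
        by (rule LIMSEQ_unique[OF limy])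
      then show ?thesis using lu by blast
    next
      case True
      then obtain x where x: "l = of_real x" by (metis complex_is_Real_iff Reals_cases)
      \<comment> \<open>At a pole \<open>rGamma\<close> vanishes, but along the sequence it equals
        \<open>exp (- logGamma)\<close> and tends to the nonzero \<open>exp (- w)\<close>.\<close>
      have "x \<notin> \<int>\<^sub>\<le>\<^sub>0"
      proof
        assume "x \<in> \<int>\<^sub>\<le>\<^sub>0"
        then have "rGamma l = 0"
          by (simp add: x rGamma_eq_zero_iff of_real_in_nonpos_Ints_iff)
        moreover have "(\<lambda>n. rGamma ((y \<circ> r) n)) \<longlonglongrightarrow> rGamma l"
          by (intro isCont_tendsto_compose[OF _ l(3)] continuous_intros)
        moreover have "(\<lambda>n. rGamma ((y \<circ> r) n)) \<longlonglongrightarrow> inverse (exp w)"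
          using tendsto_inverse[OF tendsto_exp[OF limy] exp_not_eq_zero]
          by (simp only: exp_logGamma[OF yup] rGamma_inverse_Gamma)
        ultimately show False using LIMSEQ_unique by fastforce
      qed
      then obtain m where m: "x \<in> pole_gap m" by (rule in_pole_gap_if_not_nonpos_Int)
      have "(y \<circ> r) n \<in> upper_half_plane \<and> (y \<circ> r) n \<noteq> l" for n
      proof
        show "(y \<circ> r) n \<noteq> l"
        proof
          assume "(y \<circ> r) n = l"
          then show False using yup[of n] True by (simp only: upper_half_plane_def mem_Collect_eq)
        qed
      qed (rule yup)
      then have "filterlim (y \<circ> r) (at l within upper_half_plane) sequentially"
        unfolding filterlim_at by (blast intro: l(3) always_eventually)
      from filterlim_compose[OF logGamma_tendsto_boundary[OF m, folded x] this]
      have "w = of_real (ln \<bar>Gamma x\<bar>) - \<i> * of_nat m * pi"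
        by (rule LIMSEQ_unique[OF limy])
      then have "Im w = - real m * pi" by simp
      \<comment> \<open>No integer lies strictly between \<open>k\<close> and
        \<open>k + 1\<close>.\<close>
      with w have "real k * pi < real m * pi" "real m * pi < real (k + 1) * pi"
        by linarith+
      then have "real k < real m" "real m < real (k + 1)"
        by (simp_all only: mult_less_cancel_right_pos[OF pi_gt_zero])
      then show ?thesis by simp
    qed
  qed
qed

text \<open>\<open>Ln\<close> maps the upper half plane onto the strip of heights between 0 and
  \<open>pi\<close>; lowered by \<open>(k + 1) * pi\<close>, these are the points at which
  \<open>g k\<close> evaluates \<open>logGamma_inv\<close>.\<close>

definition log_strip :: "nat \<Rightarrow> complex set" where
  "log_strip k = {w. - real (k + 1) * pi < Im w \<and> Im w < - real k * pi}"

lemma open_log_strip: "open (log_strip k)" and convex_log_strip: "convex (log_strip k)"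
proof -
  have *: "log_strip k = {w. Im w > - real (k + 1) * pi} \<inter> {w. Im w < - real k * pi}"
    by (auto simp: log_strip_def)
  show "open (log_strip k)" "convex (log_strip k)"
    unfolding * by (intro open_Int convex_Int open_halfspace_Im_gt open_halfspace_Im_lt
       convex_halfspace_Im_gt convex_halfspace_Im_lt)+
qed

text \<open>This makes limits from the upper half plane at real points unique, and lets points be
  extracted from eventual statements.\<close>

lemma at_within_upper_half_plane_neq_bot:
  "at (complex_of_real x) within upper_half_plane \<noteq> bot"
proof -
  have "(\<lambda>n. of_real x + \<i> * of_real (inverse (real (Suc n)))) \<longlonglongrightarrow> complex_of_real x + \<i> * of_real 0"
    by (intro tendsto_intros LIMSEQ_inverse_real_of_nat)
  then have "complex_of_real x islimpt upper_half_plane"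
    unfolding islimpt_sequential
    by (intro exI[of _ "\<lambda>n. of_real x + \<i> * of_real (inverse (real (Suc n)))"])
       (auto simp: upper_half_plane_def complex_eq_iff)
  then show ?thesis by (simp add: trivial_limit_within)
qed

lemma Im_logGamma_near_boundary:
  assumes "0 < e"
  obtains z where "z \<in> upper_half_plane" "\<bar>Im (logGamma z) + real m * pi\<bar> < e"
proof -
  define x where "x = 1 / 2 - real m"
  have x: "x \<in> pole_gap m" by (auto simp: x_def pole_gap_def)
  have "((\<lambda>z. Im (logGamma z)) \<longlongrightarrow> Im (of_real (ln \<bar>Gamma x\<bar>) - \<i> * of_nat m * pi))
      (at (of_real x) within upper_half_plane)"
    by (intro tendsto_intros logGamma_tendsto_boundary x)
  then have "\<forall>\<^sub>F z in at (of_real x) within upper_half_plane. \<bar>Im (logGamma z) + real m * pi\<bar> < e"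
    using assms by (simp add: tendsto_iff dist_real_def)
  moreover have "\<forall>\<^sub>F z in at (complex_of_real x) within upper_half_plane. z \<in> upper_half_plane"
    by (auto simp: eventually_at_filter)
  ultimately have "\<forall>\<^sub>F z in at (complex_of_real x) within upper_half_plane.
      z \<in> upper_half_plane \<and> \<bar>Im (logGamma z) + real m * pi\<bar> < e"
    by eventually_elim auto
  from eventually_happens'[OF at_within_upper_half_plane_neq_bot this] that show thesis by blast
qed

lemma log_strip_subset: "log_strip k \<subseteq> logGamma ` upper_half_plane"
proof -
  define A where "A = log_strip k \<inter> logGamma ` upper_half_plane"
  have "open A"
    unfolding A_def by (intro open_Int open_log_strip open_logGamma_image open_upper_half_plane) simp
  then have 1: "openin (top_of_set (log_strip k)) A"
    by (auto simp: A_def openin_open_eq open_log_strip)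
  have 2: "closedin (top_of_set (log_strip k)) A"
    unfolding closedin_limpt
  proof (intro conjI allI impI)
    show "A \<subseteq> log_strip k" by (simp add: A_def)
    fix w assume w: "w islimpt A \<and> w \<in> log_strip k"
    then obtain u where u: "\<And>n. u n \<in> A" "u \<longlonglongrightarrow> w"
      by (auto simp: islimpt_sequential)
    then obtain z where z: "\<And>n. z n \<in> upper_half_plane" "u = (\<lambda>n. logGamma (z n))"
      unfolding A_def image_def by simp metis
    then have "w \<in> logGamma ` upper_half_plane"
      using u(2) w z by (intro in_logGamma_image_if_tendsto[of z]) (auto simp: log_strip_def)
    then show "w \<in> A" using w by (simp add: A_def)
  qed
  \<comment> \<open>Nonemptiness: \<open>Im (logGamma z)\<close> comes within \<open>pi / 2\<close>
    of both edges of the strip, hence takes its midline value \<open>c\<close> by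
    connectedness.\<close>
  obtain a where a: "a \<in> upper_half_plane" "\<bar>Im (logGamma a) + real k * pi\<bar> < pi / 2"
    using Im_logGamma_near_boundary[of "pi / 2"] by auto
  obtain b where b: "b \<in> upper_half_plane" "\<bar>Im (logGamma b) + real (k + 1) * pi\<bar> < pi / 2"
    using Im_logGamma_near_boundary[of "pi / 2" "k + 1"] pi_half_gt_zero by blast
  define c where "c = - (real k + 1 / 2) * pi"
  have "connected ((\<lambda>z. Im (logGamma z)) ` upper_half_plane)"
    using holomorphic_on_imp_continuous_on[OF holomorphic_on_logGamma] convex_upper_half_plane
    by (intro connected_continuous_image continuous_on_Im convex_connected)
  moreover have "Im (logGamma b) \<le> c" "c \<le> Im (logGamma a)"
    using a(2) b(2) unfolding c_def abs_less_iff of_nat_Suc Suc_eq_plus1[symmetric]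
    by (simp_all add: algebra_simps)
  ultimately have "c \<in> (\<lambda>z. Im (logGamma z)) ` upper_half_plane"
    using a(1) b(1) connectedD_interval by blast
  then obtain z where z: "z \<in> upper_half_plane" "Im (logGamma z) = c" by auto
  then have "logGamma z \<in> A"
  proof -
    have "- (real k + 1) * pi < c" "c < - real k * pi"
      unfolding c_def by (intro mult_strict_right_mono; simp)+
    with z show ?thesis by (auto simp: A_def log_strip_def add.commute)
  qed
  then have "A \<noteq> {}" by auto
  then have "A = log_strip k"
    using connected_clopen[THEN iffD1, OF convex_connected[OF convex_log_strip]] 1 2 by blast
  then show ?thesis by (auto simp: A_def)
qed

section \<open>Critical points of Gamma\<close>

lemma pole_gap_nonzero: "x \<in> pole_gap m \<Longrightarrow> x \<noteq> 0"
  by (auto simp: pole_gap_iff)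

text \<open>The derivative is the sum of the positive terms \<open>1 / (t + k)^2\<close>. This gives
  uniqueness of the critical point and the sign of \<open>Digamma\<close> on either side of
  it.\<close>

lemma Digamma_strict_mono_on_pole_gap: "strict_mono_on (pole_gap m) (Digamma :: real \<Rightarrow> real)"
proof (rule strict_mono_onI)
  fix x y assume xy: "x \<in> pole_gap m" "y \<in> pole_gap m" "x < (y :: real)"
  then have sub: "{x..y} \<subseteq> pole_gap m" by (auto simp: pole_gap_def)
  show "Digamma x < Digamma y"
  proof (rule DERIV_pos_imp_increasing[OF xy(3)])
    fix t assume "x \<le> t" "t \<le> y"
    then have t: "t \<notin> \<int>\<^sub>\<le>\<^sub>0" using sub pole_gap_not_nonpos_Int by auto
    then have t0: "t \<noteq> 0" by auto
    have "0 < Polygamma 1 t"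
    proof -
      have s: "(\<lambda>k. inverse ((t + real k)\<^sup>2)) sums Polygamma 1 t"
        using Polygamma_LIMSEQ[OF t0, of 1] by (simp add: numeral_2_eq_2)
      have "t + real k \<noteq> 0" for k
        using t by (metis add_eq_0_iff2 minus_of_nat_in_nonpos_Ints)
      then have "0 < (\<Sum>k. inverse ((t + real k)\<^sup>2))"
        using s by (intro suminf_pos) (auto simp: sums_iff)
      with s show ?thesis by (simp add: sums_iff)
    qed
    moreover have "(Digamma has_real_derivative Polygamma 1 t) (at t)"
      using has_field_derivative_Polygamma[OF t, of 0] by simp
    ultimately show "\<exists>d. (Digamma has_real_derivative d) (at t) \<and> 0 < d" by blast
  qed
qed

lemma deriv_Gamma_eq_0_iff:
  assumes "x \<in> pole_gap m"
  shows "deriv (Gamma :: real \<Rightarrow> real) x = 0 \<longleftrightarrow> Digamma x = 0"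
proof -
  have x: "x \<notin> \<int>\<^sub>\<le>\<^sub>0" using assms by (rule pole_gap_not_nonpos_Int)
  then have "deriv (Gamma :: real \<Rightarrow> real) x = Gamma x * Digamma x"
    by (intro DERIV_imp_deriv has_field_derivative_Gamma)
  then show ?thesis using x by (simp add: Gamma_eq_zero_iff)
qed

text \<open>Rolle's theorem for \<open>rGamma\<close>, which is continuous even at the poles of
  Gamma: it vanishes at both ends of a bounded gap, and for \<open>m = 0\<close> it equals 1 at both
  1 and 2.\<close>

lemma Digamma_zero_exists: "\<exists>x \<in> pole_gap m. Digamma x = 0"
proof -
  define a b :: real where "a = (if m = 0 then 1 else - real m)" and "b = (if m = 0 then 2 else 1 - real m)"
  have ab: "a < b" by (simp add: a_def b_def)
  have gap: "x \<in> pole_gap m" if "a < x" "x < b" for x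
    using that by (auto simp: pole_gap_def a_def b_def split: if_splits)
  have "- real m \<in> \<int>\<^sub>\<le>\<^sub>0" "m \<noteq> 0 \<Longrightarrow> 1 - real m \<in> \<int>\<^sub>\<le>\<^sub>0"
    using nonpos_Ints_of_int[of "1 - int m"] by auto
  moreover have "rGamma (2 :: real) = 1" "rGamma (1 :: real) = 1"
    using Gamma_fact[of 1, where ?'a = real] by (simp_all add: rGamma_inverse_Gamma)
  ultimately have "rGamma a = rGamma b"
    by (auto simp: a_def b_def rGamma_eq_zero_iff)
  moreover have "continuous_on {a..b} (rGamma :: real \<Rightarrow> real)"
    by (intro continuous_intros)
  moreover have der: "(rGamma has_real_derivative - rGamma x * Digamma x) (at x)" if "a < x" "x < b" for x
    using pole_gap_not_nonpos_Int[OF gap[OF that]] by (intro has_field_derivative_rGamma_no_nonpos_int)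
  ultimately obtain x where x: "a < x" "x < b" "(rGamma has_real_derivative 0) (at x)"
    using Rolle[OF ab, of rGamma] real_differentiable_def by metis
  have "- rGamma x * Digamma x = 0"
    using DERIV_unique[OF der[OF x(1,2)] x(3)] .
  moreover have "rGamma x \<noteq> 0"
    using pole_gap_not_nonpos_Int[OF gap[OF x(1,2)]] by (simp add: rGamma_eq_zero_iff)
  ultimately show ?thesis using gap[OF x(1,2)] by auto
qed

lemma gamma_crit: "gamma_crit m \<in> pole_gap m" "Digamma (gamma_crit m) = 0"
proof -
  \<comment> \<open>\<open>pole_gap\<close> merges the two cases of the definition.\<close>
  have eq: "gamma_crit m = (THE x. x \<in> pole_gap m \<and> deriv (Gamma :: real \<Rightarrow> real) x = 0)"
    by (simp add: gamma_crit_def pole_gap_def add.commute conj_assoc)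
  have "\<exists>!x. x \<in> pole_gap m \<and> deriv (Gamma :: real \<Rightarrow> real) x = 0"
    using Digamma_zero_exists[of m] deriv_Gamma_eq_0_iff[of _ m]
      strict_mono_on_imp_inj_on[OF Digamma_strict_mono_on_pole_gap[of m]]
    by (auto simp: inj_on_def)
  from theI'[OF this, folded eq]
  show "gamma_crit m \<in> pole_gap m" "Digamma (gamma_crit m) = 0"
    using deriv_Gamma_eq_0_iff[of _ m] by auto
qed

text \<open>The sign is read off from \<open>(-1) ^ m * Gamma x\<close> being the exponential of a
  real number.\<close>

lemma Gamma_on_pole_gap:
  assumes "x \<in> pole_gap m"
  shows "Gamma x = (-1) ^ m * \<bar>Gamma x\<bar>"
proof -
  have G: "\<bar>Gamma x\<bar> > 0"
    using pole_gap_not_nonpos_Int[OF assms] by (simp add: Gamma_eq_zero_iff)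
  have "(-1) ^ m * Gamma (of_real x) = complex_of_real \<bar>Gamma x\<bar>"
    using exp_logGamma_branch[of "of_real x" m] logGamma_branch_of_real[OF assms] assms G
    by (simp add: exp_of_real)
  then have "complex_of_real ((-1) ^ m * Gamma x) = complex_of_real \<bar>Gamma x\<bar>"
    by (simp add: Gamma_complex_of_real)
  then have "(-1) ^ m * Gamma x = \<bar>Gamma x\<bar>"
    by (simp only: of_real_eq_iff)
  then show ?thesis by (metis minus_one_mult_self mult.assoc mult_1)
qed

lemma Gamma_gamma_crit: "Gamma (gamma_crit m) = (-1) ^ m * \<bar>Gamma (gamma_crit m)\<bar>"
  by (rule Gamma_on_pole_gap[OF gamma_crit(1)])

text \<open>The alternating signs of the critical values make both parities give the same interval,
  which has 0 in its interior.\<close>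

lemma I_slit_eq:
  "I_slit k = complex_of_real ` {- \<bar>Gamma (gamma_crit k)\<bar> .. \<bar>Gamma (gamma_crit (k + 1))\<bar>}"
  using Gamma_gamma_crit[of k] Gamma_gamma_crit[of "k + 1"] by (auto simp: I_slit_def)

text \<open>Intermediate values of \<open>\<bar>rGamma\<bar>\<close> between the critical point and
  the pole \<open>- k\<close>, where it vanishes. The solution lies to the right of the critical
  point, where \<open>Digamma\<close> is positive.\<close>

lemma abs_Gamma_attains_left:
  assumes "\<bar>Gamma (gamma_crit (Suc k))\<bar> < t"
  obtains x where "x \<in> pole_gap (Suc k)" "gamma_crit (Suc k) < x" "\<bar>Gamma x\<bar> = t"
proof -
  define c where "c = gamma_crit (Suc k)"
  have c: "c \<in> pole_gap (Suc k)" unfolding c_def by (rule gamma_crit)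
  have t: "0 < t" using assms by linarith
  have "Gamma c \<noteq> 0" using pole_gap_not_nonpos_Int[OF c] by (simp add: Gamma_eq_zero_iff)
  then have *: "inverse t < \<bar>rGamma c\<bar>"
    using assms t by (simp add: rGamma_inverse_Gamma c_def abs_inverse less_imp_inverse_less)
  have ck: "c < - real k" using c by (auto simp: pole_gap_def)
  have "rGamma (- real k) = 0" by (simp add: rGamma_eq_zero_iff)
  then have "\<exists>x\<ge>c. x \<le> - real k \<and> \<bar>rGamma x\<bar> = inverse t"
    using * t ck by (intro IVT2' continuous_intros) auto
  then obtain x where x: "c \<le> x" "x \<le> - real k" "\<bar>rGamma x\<bar> = inverse t" by blast
  have "x \<noteq> c" using x * by auto
  moreover have "x \<noteq> - real k" using x(3) t \<open>rGamma (- real k) = 0\<close> by auto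
  ultimately have "c < x" "x < - real k" using x by auto
  moreover from this have "x \<in> pole_gap (Suc k)" using c by (auto simp: pole_gap_def)
  moreover have "\<bar>Gamma x\<bar> = t"
    using x(3) by (simp add: rGamma_inverse_Gamma abs_inverse)
  ultimately show thesis using that by (simp add: c_def)
qed

text \<open>The same on the other side of the pole \<open>- k\<close>; here the solution lies to the
  left of the critical point and \<open>Digamma\<close> is negative.\<close>

lemma abs_Gamma_attains_right:
  assumes "\<bar>Gamma (gamma_crit k)\<bar> < t"
  obtains x where "x \<in> pole_gap k" "x < gamma_crit k" "\<bar>Gamma x\<bar> = t"
proof -
  define c where "c = gamma_crit k"
  have c: "c \<in> pole_gap k" unfolding c_def by (rule gamma_crit)
  have t: "0 < t" using assms by linarith
  have "Gamma c \<noteq> 0" using pole_gap_not_nonpos_Int[OF c] by (simp add: Gamma_eq_zero_iff)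
  then have *: "inverse t < \<bar>rGamma c\<bar>"
    using assms t by (simp add: rGamma_inverse_Gamma c_def abs_inverse less_imp_inverse_less)
  have ck: "- real k < c" using c by (auto simp: pole_gap_def)
  have "rGamma (- real k) = 0" by (simp add: rGamma_eq_zero_iff)
  then have "\<exists>x\<ge>- real k. x \<le> c \<and> \<bar>rGamma x\<bar> = inverse t"
    using * t ck by (intro IVT' continuous_intros) auto
  then obtain x where x: "- real k \<le> x" "x \<le> c" "\<bar>rGamma x\<bar> = inverse t" by blast
  have "x \<noteq> c" using x * by auto
  moreover have "x \<noteq> - real k" using x(3) t \<open>rGamma (- real k) = 0\<close> by auto
  ultimately have "x < c" "- real k < x" using x by auto
  moreover from this have "x \<in> pole_gap k" using c by (auto simp: pole_gap_def)
  moreover have "\<bar>Gamma x\<bar> = t"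
    using x(3) by (simp add: rGamma_inverse_Gamma abs_inverse)
  ultimately show thesis using that by (simp add: c_def)
qed

section \<open>Extension of the inverse\<close>

text \<open>Near a noncritical \<open>x\<close> the branch has a holomorphic inverse
  \<open>P\<close>. The sign of \<open>Digamma x\<close> decides whether the upper half plane is
  mapped above or below the real axis, hence on which side \<open>P\<close> agrees with the shifted
  \<open>logGamma_inv\<close>.\<close>

lemma logGamma_inv_local:
  assumes x: "x \<in> pole_gap m" and nz: "Digamma x \<noteq> 0"
  obtains W P where "open W" "of_real (ln \<bar>Gamma x\<bar>) \<in> W" "P holomorphic_on W"
    and "\<And>w. w \<in> W \<Longrightarrow> 0 < Im w * Digamma x \<Longrightarrow> logGamma_inv (w - \<i> * of_nat m * pi) = P w"
    and "\<And>w. w \<in> W \<Longrightarrow> Im w = 0 \<Longrightarrow> P w \<in> \<real>"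
proof -
  define h where "h = logGamma_branch m"
  define s where "s = Digamma x"
  \<comment> \<open>With \<open>s = Digamma x\<close> the projection equals \<open>s * s > 0\<close>
    at \<open>x\<close>, so it stays positive on a small disc and the injectivity criterion
    applies.\<close>
  have "isCont (\<lambda>z. Re (of_real s * Digamma z)) (of_real x)"
    using pole_gap_not_nonpos_Int[OF x]
    by (intro isCont_Re isCont_mult continuous_const isCont_Polygamma continuous_ident)
       (simp add: of_real_in_nonpos_Ints_iff)
  then have "((\<lambda>z. Re (of_real s * Digamma z)) \<longlongrightarrow> s * s) (nhds (of_real x))"
    using pole_gap_nonzero[OF x]
    unfolding tendsto_nhds_iff by (simp add: isCont_def Polygamma_of_real s_def)
  moreover have "0 < s * s" using nz by (auto simp: s_def zero_less_mult_iff linorder_neq_iff)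
  ultimately have "\<forall>\<^sub>F z in nhds (of_real x). 0 < Re (of_real s * Digamma z)"
    by (rule order_tendstoD(1))
  moreover have "\<forall>\<^sub>F z in nhds (of_real x). Re z \<in> pole_gap m"
    using eventually_nhds_in_open[OF open_pole_gap_strip[of m]] x by simp
  ultimately have "\<forall>\<^sub>F z in nhds (of_real x). 0 < Re (of_real s * Digamma z) \<and> Re z \<in> pole_gap m"
    by eventually_elim simp
  then obtain r where r: "r > 0"
    "\<And>z. dist z (of_real x) < r \<Longrightarrow> 0 < Re (of_real s * Digamma z) \<and> Re z \<in> pole_gap m"
    unfolding eventually_nhds_metric by blast
  define S where "S = ball (complex_of_real x) r"
  have openS: "open S" by (simp add: S_def)
  have S: "0 < Re (of_real s * Digamma z)" "Re z \<in> pole_gap m" if "z \<in> S" for z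
    using that r(2)[of z] by (simp_all add: S_def dist_commute)
  have der: "(h has_field_derivative Digamma z) (at z)" if "z \<in> S" for z
    unfolding h_def using S(2)[OF that] by (rule has_field_derivative_logGamma_branch)
  have holo: "h holomorphic_on S"
    using der holomorphic_on_open[OF openS] by blast
  have inj: "inj_on h S"
    using der S(1) by (intro inj_on_if_Re_deriv_pos[where c = "of_real s"]) (auto simp: S_def)
  obtain P where P: "P holomorphic_on (h ` S)" "\<And>z. z \<in> S \<Longrightarrow> P (h z) = z"
    using holomorphic_has_inverse[OF holo openS inj] by metis
  have real: "Im (h (of_real t)) = 0" if "of_real t \<in> S" for t
    using S(2)[OF that] by (simp add: h_def logGamma_branch_of_real)
  \<comment> \<open>Mean value theorem on the vertical segment from the real projection
    \<open>a\<close> of \<open>z\<close>, where \<open>h\<close> is real.\<close>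
  have sign: "0 < s * Im (h z) / Im z" if z: "z \<in> S" "Im z \<noteq> 0" for z
  proof -
    define a where "a = complex_of_real (Re z)"
    have za: "z - a = \<i> * of_real (Im z)" by (simp add: a_def complex_eq_iff)
    have az: "a \<noteq> z" using z by (auto simp: a_def complex_eq_iff)
    have "norm (of_real x - a) \<le> norm (of_real x - z)"
      using abs_Re_le_cmod[of "of_real x - z"] by (simp add: a_def flip: of_real_diff)
    then have aS: "a \<in> S" using z by (simp add: S_def dist_norm)
    then have seg: "closed_segment a z \<subseteq> S"
      using z by (intro closed_segment_subset) (auto simp: S_def)
    obtain u where u: "u \<in> closed_segment a z"
      "Re (of_real s * ((h z - h a) / (z - a))) = Re (of_real s * Digamma u)"
      using complex_mvt_quotient[OF az, of h Digamma "of_real s"] seg der by blast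
    have "Im (h a) = 0" using real aS by (simp add: a_def)
    then have "Re (of_real s * ((h z - h a) / (z - a))) = s * Im (h z) / Im z"
      using z by (simp add: za Re_divide power2_eq_square)
    with u S(1)[of u] seg show ?thesis by auto
  qed
  show thesis
  proof
    show "open (h ` S)"
      by (rule open_mapping_thm3[OF holo openS inj])
    have "h (of_real x) = of_real (ln \<bar>Gamma x\<bar>)"
      using x by (simp add: h_def logGamma_branch_of_real)
    moreover have "of_real x \<in> S" using r(1) by (simp add: S_def)
    ultimately show "of_real (ln \<bar>Gamma x\<bar>) \<in> h ` S" by (metis imageI)
    show "P holomorphic_on (h ` S)" by (rule P)
    fix w assume "w \<in> h ` S"
    then obtain z where z: "z \<in> S" "w = h z" by blast
    {
      assume "0 < Im w * Digamma x"
      then have pos: "0 < s * Im (h z)" by (simp add: z s_def mult.commute)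
      have "Im z \<noteq> 0"
        using real[of "Re z"] pos z(1) by (auto simp: complex_is_Real_iff of_real_Re)
      with sign[OF z(1)] pos have "Im z > 0" by (simp add: zero_less_divide_iff)
      then have zu: "z \<in> upper_half_plane" by (simp add: upper_half_plane_def)
      then have "logGamma z = w - \<i> * of_nat m * pi"
        using logGamma_eq_branch S(2)[OF z(1)] by (simp add: z h_def)
      then show "logGamma_inv (w - \<i> * of_nat m * pi) = P w"
        using logGamma_inv_logGamma[OF zu] P(2)[OF z(1)] by (simp add: z)
    next
      assume "Im w = 0"
      then have "Im z = 0" using sign[OF z(1)] z by auto
      then show "P w \<in> \<real>" using P(2)[OF z(1)] z by (simp add: complex_is_Real_iff)
    }
  qed
qed

text \<open>Local continuous extensions with real boundary values are glued into one function on the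
  closed half plane, to which the reflection principle applies.\<close>

lemma Schwarz_extension:
  assumes "open S" "cnj ` S \<subseteq> S" and f: "f holomorphic_on upper_half_plane"
    and loc: "\<And>x. of_real x \<in> S \<Longrightarrow> \<exists>V P. open V \<and> of_real x \<in> V \<and> continuous_on V P \<and>
       (\<forall>z \<in> V \<inter> upper_half_plane. f z = P z) \<and> (\<forall>z \<in> V \<inter> \<real>. P z \<in> \<real>)"
  obtains G where "G holomorphic_on S" "\<And>z. z \<in> upper_half_plane \<Longrightarrow> G z = f z"
    "\<And>z. z \<in> S \<Longrightarrow> G (cnj z) = cnj (G z)"
proof -
  \<comment> \<open>The limit depends on \<open>f\<close> alone, so the local extensions
    \<open>P\<close> need no compatible choice.\<close>
  define F where "F z = (if Im z > 0 then f z else Lim (at z within upper_half_plane) f)" for z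
  have loc': "\<exists>V P. open V \<and> of_real x \<in> V \<and> continuous_on V P \<and>
      (\<forall>z \<in> V. 0 \<le> Im z \<longrightarrow> F z = P z) \<and> (\<forall>z \<in> V \<inter> \<real>. P z \<in> \<real>)" if x: "of_real x \<in> S" for x
  proof -
    obtain V P where V: "open V" "of_real x \<in> V" "continuous_on V P"
      "\<And>z. z \<in> V \<Longrightarrow> z \<in> upper_half_plane \<Longrightarrow> f z = P z" "\<forall>z \<in> V \<inter> \<real>. P z \<in> \<real>"
      using loc[OF x] by blast
    have "F z = P z" if z: "z \<in> V" "0 \<le> Im z" for z
    proof (cases "Im z = 0")
      case True
      then obtain y where y: "z = of_real y" by (metis complex_is_Real_iff Reals_cases)
      have "isCont P z"
        using continuous_on_eq_continuous_at[OF V(1)] V(3) z(1) by blast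
      then have "(P \<longlongrightarrow> P z) (at z within upper_half_plane)"
        unfolding isCont_def by (rule tendsto_within_subset) simp
      moreover have "\<forall>\<^sub>F u in at z within upper_half_plane. f u = P u"
        unfolding eventually_at_topological using V(1,4) z(1) by (intro exI[of _ V]) auto
      ultimately have "(f \<longlongrightarrow> P z) (at z within upper_half_plane)"
        by (simp add: tendsto_cong)
      then have "Lim (at z within upper_half_plane) f = P z"
        using at_within_upper_half_plane_neq_bot[of y] by (intro tendsto_Lim) (simp_all add: y)
      then show ?thesis using True by (simp add: F_def)
    next
      case False
      then show ?thesis using z V(4) by (simp add: F_def upper_half_plane_def)
    qed
    with V show ?thesis by blast
  qed
  have cont: "continuous_on (S \<inter> {z. 0 \<le> Im z}) F"
    unfolding continuous_on_def
  proof
    fix z assume z: "z \<in> S \<inter> {z. 0 \<le> Im z}"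
    have "\<exists>V P. open V \<and> z \<in> V \<and> continuous_on V P \<and> (\<forall>u \<in> V. 0 \<le> Im u \<longrightarrow> F u = P u)"
    proof (cases "Im z = 0")
      case True
      then obtain y where y: "z = of_real y" by (metis complex_is_Real_iff Reals_cases)
      show ?thesis using loc'[of y] z unfolding y by blast
    next
      case False
      then show ?thesis
        using z f open_upper_half_plane
        by (intro exI[of _ upper_half_plane] exI[of _ f])
           (auto simp: F_def upper_half_plane_def intro: holomorphic_on_imp_continuous_on)
    qed
    then obtain V P where V: "open V" "z \<in> V" "continuous_on V P" "\<forall>u \<in> V. 0 \<le> Im u \<longrightarrow> F u = P u"
      by blast
    have "isCont P z"
      using continuous_on_eq_continuous_at[OF V(1)] V(2,3) by blast
    then have "(P \<longlongrightarrow> P z) (at z within (S \<inter> {z. 0 \<le> Im z}))"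
      unfolding isCont_def by (rule tendsto_within_subset) simp
    moreover have "\<forall>\<^sub>F u in at z within (S \<inter> {z. 0 \<le> Im z}). F u = P u"
      unfolding eventually_at_topological using V(1,2,4) by (intro exI[of _ V]) auto
    ultimately show "(F \<longlongrightarrow> F z) (at z within (S \<inter> {z. 0 \<le> Im z}))"
      using V z by (simp add: tendsto_cong)
  qed
  have reals: "F z \<in> \<real>" if z: "z \<in> S" "z \<in> \<real>" for z
  proof -
    obtain y where y: "z = of_real y" using z(2) by (rule Reals_cases)
    show ?thesis using loc'[of y] z unfolding y by fastforce
  qed
  have Ff: "F z = f z" if "z \<in> upper_half_plane" for z
    using that by (simp add: F_def upper_half_plane_def)
  have "F holomorphic_on (S \<inter> {z. 0 < Im z})"
    by (rule holomorphic_transform[OF holomorphic_on_subset[OF f]])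
       (auto simp: Ff upper_half_plane_def)
  then have "(\<lambda>z. if 0 \<le> Im z then F z else cnj (F (cnj z))) holomorphic_on S"
    using assms(1,2) cont reals by (intro Schwarz_reflection)
  then show thesis
  proof (rule that)
    fix z assume z: "z \<in> S"
    show "(if 0 \<le> Im (cnj z) then F (cnj z) else cnj (F (cnj (cnj z)))) =
        cnj (if 0 \<le> Im z then F z else cnj (F (cnj z)))"
    proof (cases "Im z = 0")
      case True
      then have "z \<in> \<real>" by (simp add: complex_is_Real_iff)
      then have "cnj z = z" "cnj (F z) = F z"
        using reals[OF z] by (simp_all add: Reals_cnj_iff)
      with True show ?thesis by simp
    qed simp
  qed (use Ff in \<open>auto simp: upper_half_plane_def\<close>)
qed

section \<open>Extending \<open>g k\<close> across the real axis outside the slit\<close>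

lemma Ln_upper_in_log_strip:
  assumes "z \<in> upper_half_plane"
  shows "Ln z - \<i> * of_int (int k + 1) * of_real pi \<in> log_strip k"
  using Im_Ln_pos_lt_imp[of z] assms
  by (simp add: log_strip_def upper_half_plane_def algebra_simps)

theorem proposition3p4:
  fixes k :: nat
  shows "\<exists>G. G holomorphic_on (- I_slit k) \<and>
             (\<forall>z. Im z \<noteq> 0 \<longrightarrow> G z = g (int k) z) \<and>
             (\<forall>z \<in> - I_slit k. G (cnj z) = cnj (G z))"
proof -
  define S where "S = - I_slit k"
  define f where "f z = logGamma_inv (Ln z - \<i> * of_int (int k + 1) * of_real pi)" for z
  have "closed (I_slit k)"
    unfolding I_slit_eq by (intro compact_imp_closed compact_continuous_image continuous_intros) auto
  then have S: "open S" by (simp add: S_def open_Compl)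
  have cnjS: "cnj ` S \<subseteq> S"
    by (force simp: S_def I_slit_eq complex_eq_iff image_iff)
  have f: "f holomorphic_on upper_half_plane"
    unfolding f_def
  proof (rule holomorphic_on_compose_gen[OF _ logGamma_inv_holomorphic, unfolded o_def])
    show "(\<lambda>z. Ln z - \<i> * of_int (int k + 1) * of_real pi) holomorphic_on upper_half_plane"
      using not_nonpos_Real_if_Im by (intro holomorphic_intros) (auto simp: upper_half_plane_def)
  qed (use Ln_upper_in_log_strip log_strip_subset in blast)
  have loc: "\<exists>V P. open V \<and> of_real t \<in> V \<and> continuous_on V P \<and>
       (\<forall>z \<in> V \<inter> upper_half_plane. f z = P z) \<and> (\<forall>z \<in> V \<inter> \<real>. P z \<in> \<real>)" if t: "of_real t \<in> S" for t
  proof -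
    consider "\<bar>Gamma (gamma_crit (Suc k))\<bar> < t" | "\<bar>Gamma (gamma_crit k)\<bar> < - t"
      using t by (force simp: S_def I_slit_eq)
    then show ?thesis
    proof cases
      \<comment> \<open>Right of the slit, \<open>Ln z\<close> has small positive imaginary part, so
        the shifted argument is just above the line of the gap \<open>Suc k\<close>. This is the
        side required by \<open>0 < Digamma x\<close>.\<close>
      case 1
      then obtain x where x: "x \<in> pole_gap (Suc k)" "gamma_crit (Suc k) < x" "\<bar>Gamma x\<bar> = t"
        by (rule abs_Gamma_attains_left)
      have pos: "0 < Digamma x"
        using strict_mono_onD[OF Digamma_strict_mono_on_pole_gap gamma_crit(1) x(1,2)] gamma_crit(2)[of "Suc k"] by simp
      then have "Digamma x \<noteq> 0" by simp
      from logGamma_inv_local[OF x(1) this] obtain W P where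
        W: "open W" "of_real (ln t) \<in> W" "P holomorphic_on W"
        "\<And>w. w \<in> W \<Longrightarrow> 0 < Im w * Digamma x \<Longrightarrow> logGamma_inv (w - \<i> * of_nat (Suc k) * pi) = P w"
        "\<And>w. w \<in> W \<Longrightarrow> Im w = 0 \<Longrightarrow> P w \<in> \<real>"
        unfolding x(3) by blast
      define V where "V = {z. Re z > 0} \<inter> Ln -` W"
      have cL: "continuous_on {z. Re z > 0} Ln"
        by (intro continuous_intros) (auto simp: complex_nonpos_Reals_iff)
      have "open V"
        using continuous_on_open_vimage[OF open_halfspace_Re_gt, THEN iffD1, OF cL] W(1)
        by (auto simp: V_def Int_commute)
      moreover have "of_real t \<in> V" using 1 W(2) by (simp add: V_def Ln_of_real)
      moreover have "continuous_on V (\<lambda>z. P (Ln z))"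
        using holomorphic_on_imp_continuous_on[OF W(3)] cL
        by (intro continuous_on_compose2[of W P V Ln]) (auto simp: V_def elim: continuous_on_subset)
      moreover have "\<forall>z \<in> V \<inter> upper_half_plane. f z = P (Ln z)"
        using W(4) pos Im_Ln_pos_lt_imp
        by (auto simp: V_def f_def upper_half_plane_def add.commute)
      moreover have "\<forall>z \<in> V \<inter> \<real>. P (Ln z) \<in> \<real>"
      proof
        fix z assume z: "z \<in> V \<inter> \<real>"
        then have "Re z > 0" "Im z = 0" "z \<noteq> 0"
          by (auto simp: V_def complex_is_Real_iff)
        then have "Im (Ln z) = 0" by (metis Im_Ln_eq_0)
        then show "P (Ln z) \<in> \<real>" using z W(5) by (simp add: V_def)
      qed
      ultimately show ?thesis by blast
    next
      \<comment> \<open>Left of the slit, \<open>Ln z\<close> is replaced by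
        \<open>Ln (- z) + i * pi\<close>, where \<open>Ln (- z)\<close> is holomorphic. The shifted
        argument is just below the line of the gap \<open>k\<close>, the side required by
        \<open>Digamma x < 0\<close>.\<close>
      case 2
      then obtain x where x: "x \<in> pole_gap k" "x < gamma_crit k" "\<bar>Gamma x\<bar> = - t"
        by (rule abs_Gamma_attains_right)
      have neg: "Digamma x < 0"
        using strict_mono_onD[OF Digamma_strict_mono_on_pole_gap x(1) gamma_crit(1) x(2)] gamma_crit(2)[of k] by simp
      then have "Digamma x \<noteq> 0" by simp
      from logGamma_inv_local[OF x(1) this] obtain W P where
        W: "open W" "of_real (ln (- t)) \<in> W" "P holomorphic_on W"
        "\<And>w. w \<in> W \<Longrightarrow> 0 < Im w * Digamma x \<Longrightarrow> logGamma_inv (w - \<i> * of_nat k * pi) = P w"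
        "\<And>w. w \<in> W \<Longrightarrow> Im w = 0 \<Longrightarrow> P w \<in> \<real>"
        unfolding x(3) by blast
      define V where "V = {z. Re z < 0} \<inter> (\<lambda>z. Ln (- z)) -` W"
      have cL: "continuous_on {z. Re z < 0} (\<lambda>z. Ln (- z))"
        by (intro continuous_intros) (auto simp: complex_nonpos_Reals_iff)
      have "open V"
        using continuous_on_open_vimage[OF open_halfspace_Re_lt, THEN iffD1, OF cL] W(1)
        by (auto simp: V_def Int_commute)
      moreover have "of_real t \<in> V" using 2 W(2) Ln_of_real[of "- t"] by (simp add: V_def)
      moreover have "continuous_on V (\<lambda>z. P (Ln (- z)))"
        using holomorphic_on_imp_continuous_on[OF W(3)] cL
        by (intro continuous_on_compose2[of W P V "\<lambda>z. Ln (- z)"]) (auto simp: V_def elim: continuous_on_subset)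
      moreover have "\<forall>z \<in> V \<inter> upper_half_plane. f z = P (Ln (- z))"
      proof
        fix z assume z: "z \<in> V \<inter> upper_half_plane"
        then have Im: "0 < Im z" by (simp add: upper_half_plane_def)
        then have nz: "z \<noteq> 0" by auto
        have Ln: "Ln (- z) = Ln z - \<i> * pi"
          using Ln_minus[OF nz] Im by simp
        then have "Im (Ln (- z)) < 0" using Im_Ln_pos_lt_imp[OF Im] by simp
        then have "0 < Im (Ln (- z)) * Digamma x" using neg by (rule mult_neg_neg)
        moreover have "Ln (- z) \<in> W" using z by (simp add: V_def)
        ultimately have "logGamma_inv (Ln (- z) - \<i> * of_nat k * pi) = P (Ln (- z))"
          by (intro W(4))
        then show "f z = P (Ln (- z))"
          unfolding Ln by (simp add: f_def algebra_simps)
      qed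
      moreover have "\<forall>z \<in> V \<inter> \<real>. P (Ln (- z)) \<in> \<real>"
      proof
        fix z assume z: "z \<in> V \<inter> \<real>"
        then have "Re (- z) > 0" "Im (- z) = 0" "- z \<noteq> 0"
          by (auto simp: V_def complex_is_Real_iff)
        then have "Im (Ln (- z)) = 0" by (metis Im_Ln_eq_0)
        then show "P (Ln (- z)) \<in> \<real>" using z W(5) by (simp add: V_def)
      qed
      ultimately show ?thesis by blast
    qed
  qed
  obtain G where G: "G holomorphic_on S" "\<And>z. z \<in> upper_half_plane \<Longrightarrow> G z = f z"
    "\<And>z. z \<in> S \<Longrightarrow> G (cnj z) = cnj (G z)"
    using Schwarz_extension[OF S cnjS f loc] by blast
  have "G z = g (int k) z" if z: "Im z \<noteq> 0" for z
  proof (cases "Im z > 0")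
    case True
    then show ?thesis using G(2)[of z] by (simp add: g_def f_def upper_half_plane_def)
  next
    case False
    then have neg: "Im z < 0" using z by simp
    then have u: "cnj z \<in> upper_half_plane" by (simp add: upper_half_plane_def)
    \<comment> \<open>The slit is real, so the symmetry of \<open>G\<close> may be applied at the
      nonreal point \<open>cnj z\<close>.\<close>
    have "cnj z \<in> S"
    proof (rule ccontr)
      assume "cnj z \<notin> S"
      then obtain x where "cnj z = of_real x" by (auto simp: S_def I_slit_eq)
      then have "Im (cnj z) = 0" by (simp only: Im_complex_of_real)
      with neg show False by simp
    qed
    from G(3)[OF this] show ?thesis
      using neg G(2)[OF u] by (simp add: g_def f_def)
  qed
  with G(1,3) show ?thesis unfolding S_def by blast
qed

end
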